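(* For every $K_3N$ $n=pqr$, $$A<\sqrt3\,\sqrt[6]{n}-\frac{1}{2\sqrt[4]{12}}\sqrt[12]{n}.$$
   Context: A $K_3N$ (Korselt number with three factors) is an integer $n$ together with a factorisation $n=pqr$, where $1<p<q<r$ are odd integers (not necessarily prime) such that each of $p-1,\ q-1,\ r-1$ divides $n-1$, and such that $E:=\dfrac{pq-1}{r-1}$ (which is an integer by the divisibility condition) satisfies $E\ge 2$. Put $H:=\gcd(p-1,q-1,r-1)$ and $A:=\frac{p-1}{H}$. *)

theory Defs
  imports Complex_Main
begin

text \<open>
  All quantities are integers. The two quotients below use integer division;
  it is exact in both cases, see \<open>K3N_E_exact\<close> and \<open>K3N_A_exact\<close>.
\<close>

definition K3N_E :: "int \<Rightarrow> int \<Rightarrow> int \<Rightarrow> int" where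
  "K3N_E p q r = (p * q - 1) div (r - 1)"

definition K3N_H :: "int \<Rightarrow> int \<Rightarrow> int \<Rightarrow> int" where
  "K3N_H p q r = gcd (p - 1) (gcd (q - 1) (r - 1))"

definition K3N_A :: "int \<Rightarrow> int \<Rightarrow> int \<Rightarrow> int" where
  "K3N_A p q r = (p - 1) div K3N_H p q r"

text \<open>Korselt numbers \<open>n\<close> with a chosen factorisation into three (not necessarily prime) factors.\<close>

definition K3N :: "int \<Rightarrow> int \<Rightarrow> int \<Rightarrow> int \<Rightarrow> bool" where
  "K3N n p q r \<longleftrightarrow>
     n = p * q * r \<and> 1 < p \<and> p < q \<and> q < r \<and> odd p \<and> odd q \<and> odd r \<and>
     (p - 1) dvd (n - 1) \<and> (q - 1) dvd (n - 1) \<and> (r - 1) dvd (n - 1) \<and>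
     K3N_E p q r \<ge> 2"

lemma K3N_E_exact:
  assumes "K3N n p q r"
  shows "real_of_int (K3N_E p q r) = (real_of_int p * real_of_int q - 1) / (real_of_int r - 1)"
proof -
  from assms have r: "r - 1 > 0" and "(r - 1) dvd (p * q * r - 1)"
    by (auto simp: K3N_def)
  moreover have "p * q * r - 1 = p * q * (r - 1) + (p * q - 1)"
    by (simp add: algebra_simps)
  ultimately have "(r - 1) dvd (p * q - 1)"
    by (metis dvd_add_right_iff dvd_triv_right)
  then have "real_of_int (K3N_E p q r) = real_of_int (p * q - 1) / real_of_int (r - 1)"
    unfolding K3N_E_def by (rule real_of_int_div)
  then show ?thesis by simp
qed

lemma K3N_A_exact:
  "real_of_int (K3N_A p q r) = (real_of_int p - 1) / real_of_int (K3N_H p q r)"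
proof -
  have "K3N_H p q r dvd p - 1"
    by (simp add: K3N_H_def)
  then have "real_of_int (K3N_A p q r) = real_of_int (p - 1) / real_of_int (K3N_H p q r)"
    unfolding K3N_A_def by (rule real_of_int_div)
  then show ?thesis by simp
qed

end

theory Submission
  imports Defs
begin

text \<open>
  Write $p = AH+1$, $q = BH+1$, $r = CH+1$. The divisibility conditions make $A$, $B$, $C$ pairwise
  coprime and give $H(AB+BC+CA)+A+B+C = kABC$ with an integer $k \ge 1$. With $h = (n/27)^{1/6}$
  the claim reads $A < 3h - \sqrt{h/8}$. If $k \ge 2$, then $kA^2 < 3(AH+1)$ and $n > (AH+1)^3$
  give $h \ge 7A/15$, which is ample. If $k = 1$, the inequality of arithmetic and geometric means
  gives $ABC \ge 27H^3$, hence $h \ge H$; comparing the equation with the point $A = B = C = 3H$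
  shows that $A$ lies below $3H$ by more than $\sqrt{H/8}$.
\<close>

lemma arith_geo_mean_3_int:
  fixes x y z :: int
  assumes "0 \<le> x" "0 \<le> y" "0 \<le> z"
  shows "27 * (x * y * z) \<le> (x + y + z) ^ 3"
proof -
  have "2 * ((x + y + z) ^ 3 - 27 * (x * y * z)) =
      (x + y + z) * ((x - y)\<^sup>2 + (y - z)\<^sup>2 + (z - x)\<^sup>2)
      + 6 * (x * (y - z)\<^sup>2 + y * (z - x)\<^sup>2 + z * (x - y)\<^sup>2)"
    by (simp add: power2_eq_square power3_eq_cube algebra_simps)
  also have "\<dots> \<ge> 0"
    using assms by (intro add_nonneg_nonneg mult_nonneg_nonneg) auto
  finally show ?thesis by simp
qed

lemma coprime_if_dvd_combination:
  fixes A B C H :: int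
  assumes "A dvd B * C * H + B + C" and "gcd A (gcd B C) = 1"
  shows "coprime A B"
proof (rule coprimeI)
  fix d assume d: "d dvd A" "d dvd B"
  then have "d dvd B * C * H + B + C" using assms(1) dvd_trans by blast
  moreover have "B * C * H + B + C = B * (C * H + 1) + C" by (simp add: algebra_simps)
  ultimately have "d dvd C" using d(2) by (metis dvd_add_right_iff dvd_mult2)
  with d have "d dvd gcd A (gcd B C)" by simp
  with assms(2) show "is_unit d" by simp
qed

lemma prod_dvd_symmetric_combination:
  fixes A B C H :: int
  assumes A: "A dvd B * C * H + B + C" and B: "B dvd C * A * H + C + A"
    and C: "C dvd A * B * H + A + B" and "gcd A (gcd B C) = 1"
  shows "A * B * C dvd H * (A * B + B * C + C * A) + A + B + C"
proof -
  let ?S = "H * (A * B + B * C + C * A) + A + B + C"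
  have AB: "coprime A B"
    using A assms(4) by (rule coprime_if_dvd_combination)
  have BC: "coprime B C"
    using B assms(4) by (intro coprime_if_dvd_combination[of B C A H]) (simp_all add: ac_simps)
  have CA: "coprime C A"
    using C assms(4) by (intro coprime_if_dvd_combination[of C A B H]) (simp_all add: ac_simps)
  have "?S = A * (H * B + H * C + 1) + (B * C * H + B + C)" by (simp add: algebra_simps)
  then have "A dvd ?S" using A by (metis dvd_add dvd_triv_left)
  moreover have "?S = B * (H * A + H * C + 1) + (C * A * H + C + A)" by (simp add: algebra_simps)
  then have "B dvd ?S" using B by (metis dvd_add dvd_triv_left)
  moreover have "?S = C * (H * A + H * B + 1) + (A * B * H + A + B)" by (simp add: algebra_simps)
  then have "C dvd ?S" using C by (metis dvd_add dvd_triv_left)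
  ultimately show ?thesis
    using AB BC CA by (intro divides_mult) (auto simp: coprime_commute)
qed

lemma pred_dvd_pred_prod_imp_dvd:
  fixes A B C H :: int
  assumes "A * H dvd (A * H + 1) * (B * H + 1) * (C * H + 1) - 1" and "H \<noteq> 0"
  shows "A dvd B * C * H + B + C"
proof -
  have "(A * H + 1) * (B * H + 1) * (C * H + 1) - 1
      = (A * H) * ((B * H + 1) * (C * H + 1)) + (B * C * H + B + C) * H"
    by (simp add: algebra_simps)
  with assms(1) have "A * H dvd (B * C * H + B + C) * H"
    by (metis dvd_add_right_iff dvd_triv_left)
  with assms(2) show ?thesis by simp
qed

lemma K3N_parametrization:
  assumes "K3N n p q r"
  obtains A B C H k :: int where
    "K3N_A p q r = A" "n = (A * H + 1) * (B * H + 1) * (C * H + 1)"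
    "0 < A" "A < B" "B < C" "2 \<le> H" "1 \<le> k"
    "H * (A * B + B * C + C * A) + A + B + C = k * (A * B * C)"
proof -
  define H where "H = K3N_H p q r"
  define A B C where "A = (p - 1) div H" and "B = (q - 1) div H" and "C = (r - 1) div H"
  from assms have n: "n = p * q * r" and pqr: "1 < p" "p < q" "q < r"
    and odds: "odd p" "odd q" "odd r"
    and dvds: "p - 1 dvd n - 1" "q - 1 dvd n - 1" "r - 1 dvd n - 1"
    by (auto simp: K3N_def)
  have H_dvd: "H dvd p - 1" "H dvd q - 1" "H dvd r - 1"
    unfolding H_def K3N_H_def by (simp_all add: dvd_trans[OF gcd_dvd2])
  have "H > 0" using pqr by (simp add: H_def K3N_H_def)
  moreover have "2 dvd H" using odds by (simp add: H_def K3N_H_def)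
  ultimately have H: "2 \<le> H" using zdvd_imp_le by blast
  have p1: "p - 1 = A * H" and q1: "q - 1 = B * H" and r1: "r - 1 = C * H"
    using H_dvd by (simp_all add: A_def B_def C_def)
  then have p: "p = A * H + 1" and q: "q = B * H + 1" and r: "r = C * H + 1" by auto
  have "A * H > 0" using p pqr(1) by linarith
  then have "0 < A" using H by (simp add: zero_less_mult_iff)
  have "A * H < B * H" "B * H < C * H" using pqr(2,3) p1 q1 r1 by linarith+
  with H have "A < B" "B < C" by (simp_all add: mult_less_cancel_right)
  have "gcd (A * H) (gcd (B * H) (C * H)) = H"
    using H_def by (simp add: K3N_H_def p q r)
  moreover have "gcd (A * H) (gcd (B * H) (C * H)) = gcd A (gcd B C) * H"
    using H gcd_mult_distrib_int[of H B C] gcd_mult_distrib_int[of H A "gcd B C"]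
    by (simp add: mult.commute)
  ultimately have "gcd A (gcd B C) * H = 1 * H" by simp
  with H have gcd1: "gcd A (gcd B C) = 1" by simp
  have n': "n = (A * H + 1) * (B * H + 1) * (C * H + 1)"
    using n p q r by simp
  have "A dvd B * C * H + B + C"
    using dvds(1) H by (intro pred_dvd_pred_prod_imp_dvd) (simp_all add: n' p ac_simps)
  moreover have "B dvd C * A * H + C + A"
    using dvds(2) H by (intro pred_dvd_pred_prod_imp_dvd) (simp_all add: n' q ac_simps)
  moreover have "C dvd A * B * H + A + B"
    using dvds(3) H by (intro pred_dvd_pred_prod_imp_dvd) (simp_all add: n' r ac_simps)
  ultimately have "A * B * C dvd H * (A * B + B * C + C * A) + A + B + C"
    using gcd1 by (rule prod_dvd_symmetric_combination)
  then obtain k where k: "H * (A * B + B * C + C * A) + A + B + C = k * (A * B * C)"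
    by (metis dvd_def mult.commute)
  have "0 < H * (A * B + B * C + C * A) + A + B + C"
    using \<open>0 < A\<close> \<open>A < B\<close> \<open>B < C\<close> H by (intro add_pos_pos mult_pos_pos) auto
  moreover have "0 < A * B * C" using \<open>0 < A\<close> \<open>A < B\<close> \<open>B < C\<close> by simp
  ultimately have "1 \<le> k" unfolding k by (simp add: zero_less_mult_iff)
  with that[of A H B C k] show thesis
    using n' \<open>0 < A\<close> \<open>A < B\<close> \<open>B < C\<close> H k by (simp add: K3N_A_def A_def H_def)
qed

lemma symmetric_equation_quadratic_bound:
  fixes A B C H k :: int
  assumes "0 < A" "A < B" "B < C" "0 < H"
    and eq: "H * (A * B + B * C + C * A) + A + B + C = k * (A * B * C)"
  shows "k * A\<^sup>2 < 3 * (A * H + 1)"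
proof -
  have AB: "A * B < B * C" and AC: "A * C < B * C" and AA: "A * A < B * C"
    using assms mult_strict_left_mono[of A C B] mult_strict_right_mono[of A B C]
      mult_strict_mono[of A B A C] by (auto simp: mult.commute[of B A])
  have "k * A\<^sup>2 * (B * C) = A * (k * (A * B * C))"
    by (simp add: power2_eq_square)
  also have "\<dots> = A * H * (A * B + B * C + A * C) + (A * A + A * B + A * C)"
    unfolding eq[symmetric] by (simp add: algebra_simps)
  also have "\<dots> < A * H * (3 * (B * C)) + 3 * (B * C)"
  proof (rule add_le_less_mono)
    show "A * H * (A * B + B * C + A * C) \<le> A * H * (3 * (B * C))"
    proof (rule mult_left_mono)
      show "A * B + B * C + A * C \<le> 3 * (B * C)" using AB AC by linarith
      show "0 \<le> A * H" using assms by simp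
    qed
    show "A * A + A * B + A * C < 3 * (B * C)" using AB AC AA by linarith
  qed
  also have "\<dots> = 3 * (A * H + 1) * (B * C)" by (simp add: algebra_simps)
  finally show ?thesis using assms by (simp add: mult_less_cancel_right)
qed

lemma symmetric_equation_prod_ge:
  fixes A B C H :: int
  assumes "0 < A" "0 < B" "0 < C" "0 < H"
    and eq: "H * (A * B + B * C + C * A) + A + B + C = A * B * C"
  shows "27 * H ^ 3 \<le> A * B * C"
proof -
  have "27 * H ^ 3 * (A * B * C)\<^sup>2 = H ^ 3 * (27 * ((A * B) * (B * C) * (C * A)))"
    by (simp add: power2_eq_square)
  also have "\<dots> \<le> H ^ 3 * (A * B + B * C + C * A) ^ 3"
    using assms by (intro mult_left_mono arith_geo_mean_3_int) auto
  also have "\<dots> = (H * (A * B + B * C + C * A)) ^ 3" by (simp add: power_mult_distrib)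
  also have "\<dots> \<le> (A * B * C) ^ 3"
    unfolding eq[symmetric] using assms by (intro power_mono) auto
  also have "\<dots> = A * B * C * (A * B * C)\<^sup>2" by (simp add: power2_eq_square power3_eq_cube)
  finally show ?thesis
    using assms by (simp add: mult_le_cancel_right zero_less_mult_iff)
qed

lemma symmetric_equation_less_triple:
  fixes A B C H :: int
  assumes "0 < A" "A < B" "B < C" "1 \<le> H"
    and eq: "H * (A * B + B * C + C * A) + A + B + C = A * B * C"
  shows "A < 3 * H"
proof (rule ccontr)
  assume "\<not> A < 3 * H"
  then have "3 * H * (B * C) \<le> A * (B * C)"
    using assms by (intro mult_right_mono) auto
  also have "\<dots> = H * (A * B + B * C + C * A) + A + B + C" using eq by simp
  also have "\<dots> \<le> H * (3 * (B * C) - 2 * B - C) + A + B + C"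
  proof -
    have "B * A \<le> B * (C - 2)" "C * A \<le> C * (B - 1)"
      using assms by (auto intro!: mult_left_mono)
    then show ?thesis
      using assms by (intro add_right_mono mult_left_mono) (auto simp: algebra_simps)
  qed
  also have "\<dots> = 3 * H * (B * C) - H * (2 * B + C) + A + B + C"
    by (simp add: algebra_simps)
  finally have "H * (2 * B + C) \<le> A + B + C" by linarith
  moreover have "1 * (2 * B + C) \<le> H * (2 * B + C)"
    using assms by (intro mult_right_mono) auto
  ultimately have "1 * (2 * B + C) \<le> A + B + C" by (rule order_trans[rotated])
  with assms(2) show False by simp
qed

text \<open>
  With $A = 3H-a$, $B = 3H+b$, $C = 3H+c$ the equation is dominated by $3H^2(b+c-a)$, while a small
  $a$ keeps the remaining terms under control, both for $b+c-a \ge 1$ and for $b+c-a \le 0$.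
\<close>

lemma symmetric_equation_gap:
  fixes A B C H :: int
  assumes "0 < A" "A < B" "B < C" "1 \<le> H"
    and eq: "H * (A * B + B * C + C * A) + A + B + C = A * B * C"
  shows "H < 8 * (3 * H - A)\<^sup>2"
proof (rule ccontr)
  assume small: "\<not> ?thesis"
  define a b c s where "a = 3 * H - A" and "b = B - 3 * H" and "c = C - 3 * H"
    and "s = b + c - a"
  have abc: "A = 3 * H - a" "B = 3 * H + b" "C = 3 * H + c" by (auto simp: a_def b_def c_def)
  have c: "c = s + a - b" by (simp add: s_def)
  have a: "1 \<le> a" using symmetric_equation_less_triple[OF assms] by (simp add: a_def)
  have aH: "8 * a\<^sup>2 \<le> H" using small by (simp add: a_def)
  have "a * 1 \<le> a * a" using a by (intro mult_left_mono) auto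
  with aH have aH': "8 * a \<le> H" by (simp add: power2_eq_square)
  have products: "H * (8 * a) \<le> H * H" "H * 8 \<le> H * H"
    using a aH' assms(4) by (auto intro!: mult_left_mono)
  have b: "- a < b" "b < c" using assms(2,3) by (auto simp: abc)
  have main: "(3 * H\<^sup>2 - 1) * s - 2 * H * a * (s + a) + (2 * H - a) * (b * c) = 9 * H"
    using eq unfolding abc c by (simp add: algebra_simps power2_eq_square)
  show False
  proof (cases "1 \<le> s")
    case True
    have "- (a * (s + 2 * a)) \<le> b * c"
    proof (cases "0 \<le> b")
      case True
      moreover have "0 \<le> a * (s + 2 * a)" using a \<open>1 \<le> s\<close> by auto
      ultimately show ?thesis using b by (smt (verit) mult_nonneg_nonneg)
    next
      case False
      have "(- b) * c \<le> a * (s + 2 * a)"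
        using False b a True by (intro mult_mono) (auto simp: c)
      then show ?thesis by simp
    qed
    then have "(2 * H - a) * (- (a * (s + 2 * a))) \<le> (2 * H - a) * (b * c)"
      using a aH' by (intro mult_left_mono) auto
    moreover have "0 \<le> a * (a * (s + 2 * a))" using a True by auto
    ultimately have upper: "(3 * H\<^sup>2 - 1 - 4 * H * a) * s \<le> 9 * H + 6 * (H * a\<^sup>2)"
      using main by (simp add: algebra_simps power2_eq_square)
    have "0 \<le> 3 * H\<^sup>2 - 1 - 4 * H * a"
      using products a aH' unfolding power2_eq_square by linarith
    then have "(3 * H\<^sup>2 - 1 - 4 * H * a) * 1 \<le> (3 * H\<^sup>2 - 1 - 4 * H * a) * s"
      using True by (intro mult_left_mono) auto
    with upper have "3 * H\<^sup>2 - 1 - 4 * H * a \<le> 9 * H + 6 * (H * a\<^sup>2)" by simp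
    moreover have "H * (8 * a\<^sup>2) \<le> H * H"
      using aH assms(4) by (intro mult_left_mono) auto
    ultimately show False
      using products a aH' unfolding power2_eq_square by linarith
  next
    case False
    have "b * c \<le> a\<^sup>2"
    proof -
      have "4 * (b * c) = (b + c)\<^sup>2 - (b - c)\<^sup>2" by (simp add: power2_eq_square algebra_simps)
      also have "\<dots> \<le> (b + c)\<^sup>2" by simp
      also have "\<dots> \<le> (2 * a)\<^sup>2"
        using b False a by (intro abs_le_square_iff[THEN iffD1]) (auto simp: c)
      finally show ?thesis by (simp add: power2_eq_square)
    qed
    then have "(2 * H - a) * (b * c) \<le> (2 * H - a) * a\<^sup>2"
      using a aH' by (intro mult_left_mono) auto
    moreover have "0 \<le> a * a\<^sup>2" using a by auto
    ultimately have "9 * H \<le> (3 * H\<^sup>2 - 1 - 2 * H * a) * s"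
      using main by (simp add: algebra_simps power2_eq_square)
    moreover have "0 \<le> 3 * H\<^sup>2 - 1 - 2 * H * a"
      using products a aH' unfolding power2_eq_square by linarith
    then have "(3 * H\<^sup>2 - 1 - 2 * H * a) * s \<le> 0"
      using False by (intro mult_nonneg_nonpos) auto
    ultimately show False using assms(4) by linarith
  qed
qed

lemma bound_from_sixth_power:
  fixes x t N :: real
  assumes t: "1 / 8 \<le> t" and N: "27 * t ^ 6 \<le> N" and x: "x < 3 * t - sqrt (t / 8)"
  shows "x < sqrt 3 * root 6 N - 1 / (2 * root 4 12) * root 12 N"
proof -
  define h where "h = root 6 N / sqrt 3"
  have N0: "0 \<le> N" using N t by (intro order_trans[OF _ N]) simp
  have root6: "root 6 N = sqrt 3 * h" by (simp add: h_def)
  have "sqrt 3 ^ 6 = (27 :: real)"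
    using power_mult[of "sqrt 3" 2 3] by simp
  then have "sqrt 3 * t = root 6 (27 * t ^ 6)"
    using t by (intro real_root_pos_unique[symmetric]) (auto simp: power_mult_distrib)
  also have "\<dots> \<le> root 6 N" using N by simp
  finally have th: "t \<le> h" using root6 by simp
  have root4: "root 4 12 = sqrt (2 * sqrt 3)"
  proof -
    have "root 4 12 = sqrt (sqrt 12)" using real_root_mult_exp[of 2 2 12] by (simp add: sqrt_def)
    also have "sqrt 12 = 2 * sqrt 3" using real_sqrt_mult[of 4 3] by simp
    finally show ?thesis .
  qed
  have "root 12 N = sqrt (root 6 N)"
    using real_root_mult_exp[of 2 6 N] by (simp add: sqrt_def)
  also have "\<dots> = sqrt (2 * sqrt 3 * (4 * (h / 8)))" by (simp add: root6)
  also have "\<dots> = root 4 12 * (2 * sqrt (h / 8))"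
    unfolding root4 real_sqrt_mult by simp
  finally have root12: "1 / (2 * root 4 12) * root 12 N = sqrt (h / 8)" by simp
  have rhs: "sqrt 3 * root 6 N - 1 / (2 * root 4 12) * root 12 N = 3 * h - sqrt (h / 8)"
    unfolding root12 root6 by (simp flip: mult.assoc)
  define u v where "u = sqrt (t / 8)" and "v = sqrt (h / 8)"
  have "sqrt ((1 / 8)\<^sup>2) \<le> u"
    unfolding u_def using t by (intro real_sqrt_le_mono) (simp add: power2_eq_square)
  then have u: "1 / 8 \<le> u" by simp
  have v: "u \<le> v" using th by (simp add: u_def v_def)
  have "t = 8 * u\<^sup>2" "h = 8 * v\<^sup>2" using t th by (auto simp: u_def v_def)
  moreover have "0 \<le> (v - u) * (24 * (u + v) - 1)"
    using u v by (intro mult_nonneg_nonneg) auto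
  ultimately have "3 * t - u \<le> 3 * h - v"
    by (simp add: power2_eq_square algebra_simps)
  with x show ?thesis unfolding rhs u_def v_def by linarith
qed

theorem theorem4p7:
  fixes n p q r :: int
  assumes "K3N n p q r"
  shows "real_of_int (K3N_A p q r) <
           sqrt 3 * root 6 (real_of_int n) - 1 / (2 * root 4 12) * root 12 (real_of_int n)"
proof -
  from assms obtain A B C H k :: int where A: "K3N_A p q r = A"
    and n: "n = (A * H + 1) * (B * H + 1) * (C * H + 1)"
    and ABC: "0 < A" "A < B" "B < C" and H: "2 \<le> H" and k: "1 \<le> k"
    and eq: "H * (A * B + B * C + C * A) + A + B + C = k * (A * B * C)"
    by (rule K3N_parametrization)
  show ?thesis
  proof (cases "k = 1")
    case True
    with eq have eq1: "H * (A * B + B * C + C * A) + A + B + C = A * B * C" by simp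
    have "27 * H ^ 3 * H ^ 3 \<le> A * B * C * H ^ 3"
      using symmetric_equation_prod_ge[OF _ _ _ _ eq1] ABC H by (intro mult_right_mono) auto
    also have "\<dots> = (A * H) * (B * H) * (C * H)" by (simp add: power3_eq_cube)
    also have "\<dots> \<le> n"
      unfolding n using ABC H by (intro mult_mono) auto
    finally have "27 * H ^ 6 \<le> n" by (simp add: eval_nat_numeral mult.assoc)
    then have "real_of_int (27 * H ^ 6) \<le> real_of_int n" by (simp only: of_int_le_iff)
    then have "27 * real_of_int H ^ 6 \<le> real_of_int n" by simp
    moreover have "real_of_int A < 3 * real_of_int H - sqrt (real_of_int H / 8)"
    proof -
      have "real_of_int H < real_of_int (8 * (3 * H - A)\<^sup>2)"
        using symmetric_equation_gap[OF _ _ _ _ eq1] ABC H by (subst of_int_less_iff) auto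
      then have "real_of_int H / 8 < (3 * real_of_int H - real_of_int A)\<^sup>2" by simp
      moreover have "0 \<le> 3 * real_of_int H - real_of_int A"
        using symmetric_equation_less_triple[OF _ _ _ _ eq1] ABC H by simp
      ultimately have "sqrt (real_of_int H / 8) < 3 * real_of_int H - real_of_int A"
        by (intro real_less_lsqrt) auto
      then show ?thesis by simp
    qed
    ultimately show ?thesis
      unfolding A using H by (intro bound_from_sixth_power) auto
  next
    case False
    with k have "2 * A\<^sup>2 \<le> k * A\<^sup>2" by (intro mult_right_mono) auto
    also have "\<dots> < 3 * (A * H + 1)"
      using ABC H eq by (intro symmetric_equation_quadratic_bound) auto
    finally have "(2 * A\<^sup>2) ^ 3 \<le> (3 * (A * H + 1)) ^ 3" by (intro power_mono) auto
    also have "\<dots> = 27 * ((A * H + 1) * (A * H + 1) * (A * H + 1))"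
      unfolding power_mult_distrib by (simp add: power3_eq_cube)
    also have "\<dots> \<le> 27 * n"
      unfolding n using ABC H by (intro mult_left_mono mult_mono) auto
    finally have "8 * A ^ 6 \<le> 27 * n" by (simp add: power_mult_distrib flip: power_mult)
    then have "real_of_int (8 * A ^ 6) \<le> real_of_int (27 * n)" by (simp only: of_int_le_iff)
    then have "8 * real_of_int A ^ 6 \<le> 27 * real_of_int n" by simp
    moreover have "27 * (7 / 15 * real_of_int A) ^ 6 = 27 * (7 / 15) ^ 6 * real_of_int A ^ 6"
      unfolding power_mult_distrib by simp
    moreover have "27 * (7 / 15) ^ 6 * real_of_int A ^ 6 \<le> 8 / 27 * real_of_int A ^ 6"
      by (intro mult_right_mono) (simp_all add: power_divide)
    ultimately have "27 * (7 / 15 * real_of_int A) ^ 6 \<le> real_of_int n" by linarith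
    moreover have "real_of_int A < 3 * (7 / 15 * real_of_int A) - sqrt (7 / 15 * real_of_int A / 8)"
    proof -
      have "1 * real_of_int A \<le> real_of_int A * real_of_int A"
        using ABC by (intro mult_right_mono) auto
      then have "7 / 15 * real_of_int A / 8 < (2 / 5 * real_of_int A)\<^sup>2"
        using ABC by (simp add: power2_eq_square)
      then have "sqrt (7 / 15 * real_of_int A / 8) < 2 / 5 * real_of_int A"
        using ABC by (intro real_less_lsqrt) auto
      then show ?thesis by simp
    qed
    ultimately show ?thesis
      unfolding A using ABC by (intro bound_from_sixth_power) auto
  qed
qed

end
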